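(* Let $H$ be a complex Hilbert space, let $a, b \in E(H)$ and let $\mathcal{M}_1$ be the von Neumann algebra generated by $a$ and $b$. Let $x_0 \in B(H)^+$ lie in the centre of $\mathcal{M}_1$ with $\Vert x_0 \Vert < 1$. Then: (1) If $a \triangle_{x_0} b$, then $a, b \in [\frac12 x_0, I - \frac12 x_0]$. (2) $a \triangle_{x_0} b$ if and only if $(I - x_0)^{-1}(a - \frac12 x_0) \triangle (I - x_0)^{-1}(b - \frac12 x_0)$. (3) If $a \triangle_{x_0} b$, then $a \dot{\wedge} b,\ a \dot{\vee} b \in [\frac12 x_0, I - \frac12 x_0]$.
   Context: $B(H)$ is the algebra of bounded linear operators on $H$, $B(H)_{sa}$ its self-adjoint part, $B(H)^+$ its positive operators, $I$ the identity operator, and $E(H) = \{a \in B(H)_{sa} : 0 \le a \le I\}$ the set of effects. The von Neumann algebra generated by $a$ and $b$ contains $I$. For $u \in B(H)$, $|u| := (u^*u)^{1/2}$. For $u, v \in B(H)_{sa}$, $[u,v] := \{w \in B(H)_{sa} : u \le w \le v\}$, $u \dot{\wedge} v := \frac12(u + v - |u - v|)$ and $u \dot{\vee} v := \frac12(u + v + |u - v|)$. The relation $u \triangle v$ (absolute compatibility) means that $u, v \in E(H)$ and $|u - v| + |I - u - v| = I$. For $a, b \in E(H)$ and $x_0 \in E(H)$ with $\Vert x_0\Vert < 1$ lying in the centre of the von Neumann algebra generated by $a$ and $b$, $a \triangle_{x_0} b$ ($a$ is $x_0$-compatible with $b$) means $|a - b| + |I - a - b| = I - x_0$. *)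

theory Defs
  imports "HOL-Analysis.Analysis"
begin

(* Complex Hilbert spaces.  Re (cinner x y) is required to be the library's real inner
   product, so norm, metric and topology are the usual ones and cinner is positive definite.
   cinner is linear in its first argument. *)
class complex_hilbert_space = real_inner + complete_space +
  fixes scaleC :: "complex \<Rightarrow> 'a \<Rightarrow> 'a"
    and cinner :: "'a \<Rightarrow> 'a \<Rightarrow> complex"
  assumes scaleC_add_right: "scaleC c (x + y) = scaleC c x + scaleC c y"
    and scaleC_add_left: "scaleC (c + d) x = scaleC c x + scaleC d x"
    and scaleC_scaleC: "scaleC c (scaleC d x) = scaleC (c * d) x"
    and scaleR_scaleC: "r *\<^sub>R x = scaleC (complex_of_real r) x"
    and cinner_commute: "cinner x y = cnj (cinner y x)"
    and cinner_add_left: "cinner (x + y) z = cinner x z + cinner y z"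
    and cinner_scaleC_left: "cinner (scaleC c x) y = c * cinner x y"
    and inner_eq_Re_cinner: "inner x y = Re (cinner x y)"

lemma norm_scaleC: "norm (scaleC c x) = cmod c * norm x"
  for x :: "'a::complex_hilbert_space"
proof -
  have "cinner x (scaleC c x) = cnj c * cinner x x"
    by (metis cinner_commute cinner_scaleC_left complex_cnj_mult)
  then have "cinner (scaleC c x) (scaleC c x) = (c * cnj c) * cinner x x"
    by (simp add: cinner_scaleC_left)
  also have "c * cnj c = complex_of_real ((cmod c)\<^sup>2)"
    by (rule complex_norm_square [symmetric])
  finally have "inner (scaleC c x) (scaleC c x) = (cmod c)\<^sup>2 * inner x x"
    by (simp add: inner_eq_Re_cinner)
  then show ?thesis
    by (simp add: norm_eq_sqrt_inner real_sqrt_mult)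
qed

lemma bounded_linear_scaleC: "bounded_linear (scaleC c :: 'a \<Rightarrow> 'a::complex_hilbert_space)"
  by (rule bounded_linear_intro [where K = "cmod c"])
    (simp_all add: scaleC_add_right scaleR_scaleC scaleC_scaleC mult.commute norm_scaleC)

(* B(H), as the complex-linear elements of the library's space of bounded real-linear maps. *)
definition bounded_ops :: "('a::complex_hilbert_space \<Rightarrow>\<^sub>L 'a) set" where
  "bounded_ops = {T :: 'a \<Rightarrow>\<^sub>L 'a. \<forall>c x. T (scaleC c x) = scaleC c (T x)}"

lift_definition scaleC_op ::
  "complex \<Rightarrow> ('a::complex_hilbert_space \<Rightarrow>\<^sub>L 'a) \<Rightarrow> ('a \<Rightarrow>\<^sub>L 'a)"
  is "\<lambda>c f x. scaleC c (f x)"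
  by (rule bounded_linear_compose [OF bounded_linear_scaleC])

definition adj :: "('a::complex_hilbert_space \<Rightarrow>\<^sub>L 'a) \<Rightarrow> ('a \<Rightarrow>\<^sub>L 'a)" where
  "adj T = (THE S. S \<in> bounded_ops \<and> (\<forall>x y. cinner (T x) y = cinner x (S y)))"

definition selfadjoint_ops :: "('a::complex_hilbert_space \<Rightarrow>\<^sub>L 'a) set" where
  "selfadjoint_ops = {T \<in> bounded_ops. adj T = T}"

(* For self-adjoint T the number cinner (T x) x is real. *)
definition positive_ops :: "('a::complex_hilbert_space \<Rightarrow>\<^sub>L 'a) set" where
  "positive_ops = {T \<in> selfadjoint_ops. \<forall>x. 0 \<le> Re (cinner (T x) x)}"

definition op_le :: "('a::complex_hilbert_space \<Rightarrow>\<^sub>L 'a) \<Rightarrow> ('a \<Rightarrow>\<^sub>L 'a) \<Rightarrow> bool" where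
  "op_le u v \<longleftrightarrow> v - u \<in> positive_ops"

definition op_interval ::
  "('a::complex_hilbert_space \<Rightarrow>\<^sub>L 'a) \<Rightarrow> ('a \<Rightarrow>\<^sub>L 'a) \<Rightarrow> ('a \<Rightarrow>\<^sub>L 'a) set" where
  "op_interval u v = {w \<in> selfadjoint_ops. op_le u w \<and> op_le w v}"

definition effects :: "('a::complex_hilbert_space \<Rightarrow>\<^sub>L 'a) set" where
  "effects = {a \<in> selfadjoint_ops. op_le 0 a \<and> op_le a id_blinfun}"

definition op_sqrt :: "('a::complex_hilbert_space \<Rightarrow>\<^sub>L 'a) \<Rightarrow> ('a \<Rightarrow>\<^sub>L 'a)" where
  "op_sqrt T = (THE S. S \<in> positive_ops \<and> S o\<^sub>L S = T)"

definition op_abs :: "('a::complex_hilbert_space \<Rightarrow>\<^sub>L 'a) \<Rightarrow> ('a \<Rightarrow>\<^sub>L 'a)" where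
  "op_abs u = op_sqrt (adj u o\<^sub>L u)"

definition op_inverse :: "('a::complex_hilbert_space \<Rightarrow>\<^sub>L 'a) \<Rightarrow> ('a \<Rightarrow>\<^sub>L 'a)" where
  "op_inverse T =
     (THE S. S \<in> bounded_ops \<and> S o\<^sub>L T = id_blinfun \<and> T o\<^sub>L S = id_blinfun)"

definition dot_wedge ::
  "('a::complex_hilbert_space \<Rightarrow>\<^sub>L 'a) \<Rightarrow> ('a \<Rightarrow>\<^sub>L 'a) \<Rightarrow> ('a \<Rightarrow>\<^sub>L 'a)" where
  "dot_wedge u v = (1/2) *\<^sub>R (u + v - op_abs (u - v))"

definition dot_vee ::
  "('a::complex_hilbert_space \<Rightarrow>\<^sub>L 'a) \<Rightarrow> ('a \<Rightarrow>\<^sub>L 'a) \<Rightarrow> ('a \<Rightarrow>\<^sub>L 'a)" where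
  "dot_vee u v = (1/2) *\<^sub>R (u + v + op_abs (u - v))"

(* Unital *-subalgebras of B(H) closed in the strong operator topology.  That topology lives
   on the bounded real-linear maps, in which bounded_ops is itself strongly closed, so this is
   the same as being closed relative to B(H). *)
definition von_neumann_algebra :: "('a::complex_hilbert_space \<Rightarrow>\<^sub>L 'a) set \<Rightarrow> bool" where
  "von_neumann_algebra M \<longleftrightarrow>
     M \<subseteq> bounded_ops \<and> id_blinfun \<in> M \<and>
     (\<forall>S\<in>M. \<forall>T\<in>M. S + T \<in> M \<and> S o\<^sub>L T \<in> M) \<and>
     (\<forall>c. \<forall>T\<in>M. scaleC_op c T \<in> M) \<and>
     (\<forall>T\<in>M. adj T \<in> M) \<and>
     closedin strong_operator_topology M"

definition generated_von_neumann_algebra ::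
  "('a::complex_hilbert_space \<Rightarrow>\<^sub>L 'a) set \<Rightarrow> ('a \<Rightarrow>\<^sub>L 'a) set" where
  "generated_von_neumann_algebra A = \<Inter> {M. von_neumann_algebra M \<and> A \<subseteq> M}"

definition op_centre ::
  "('a::complex_hilbert_space \<Rightarrow>\<^sub>L 'a) set \<Rightarrow> ('a \<Rightarrow>\<^sub>L 'a) set" where
  "op_centre M = {z \<in> M. \<forall>w\<in>M. z o\<^sub>L w = w o\<^sub>L z}"

definition abs_compatible ::
  "('a::complex_hilbert_space \<Rightarrow>\<^sub>L 'a) \<Rightarrow> ('a \<Rightarrow>\<^sub>L 'a) \<Rightarrow> bool" where
  "abs_compatible u v \<longleftrightarrow>
     u \<in> effects \<and> v \<in> effects \<and>
     op_abs (u - v) + op_abs (id_blinfun - u - v) = id_blinfun"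

(* compatible_rel x0 a b: a is x0-compatible with b. *)
definition compatible_rel ::
  "('a::complex_hilbert_space \<Rightarrow>\<^sub>L 'a) \<Rightarrow> ('a \<Rightarrow>\<^sub>L 'a) \<Rightarrow> ('a \<Rightarrow>\<^sub>L 'a) \<Rightarrow> bool" where
  "compatible_rel x0 a b \<longleftrightarrow>
     a \<in> effects \<and> b \<in> effects \<and> x0 \<in> effects \<and> norm x0 < 1 \<and>
     x0 \<in> op_centre (generated_von_neumann_algebra {a, b}) \<and>
     op_abs (a - b) + op_abs (id_blinfun - a - b) = id_blinfun - x0"

end

(* Let p = |a - b|, q = |I - a - b|, w = I - a - b. If p + q = I - x0, each of the differences
   between a, b, the two lattice-like expressions and the bounds x0/2, I - x0/2 is half a sum of
   terms p, p + (a - b), p - (a - b), q + w, q - w, which are positive because |u| + u and |u| - u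
   are positive for self-adjoint u. Since S = (I - x0)^(-1) is positive and commutes with a and b,
   |S u| = S |u| for u = a - b and u = I - a - b, and these S u are the corresponding differences
   for the rescaled effects; multiplying by S turns one compatibility equation into the other. *)

theory Submission
  imports Defs
begin

text \<open>\<open>adj\<close>, \<open>op_sqrt\<close> and \<open>op_inverse\<close> are definite
  descriptions, so existence and uniqueness must precede any computation with them. The obstacle is
  that positivity of |u| + u belongs to functional calculus, whereas the tool built here is only the
  square root. What replaces the calculus is that the constructed root of T commutes with every
  operator commuting with T: this yields uniqueness of roots and positivity of products of commuting
  positive operators. Centrality of \<open>x0\<close> lets its resolvent S enter such products. The
  constant 1/2 balances the rescaling. With h = x0/2 one has S(I - 2h) = I, so T -> S(T - h) sends h
  to 0 and I - h to I. Hence the interval in (1) is what makes the rescaled operators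
  effects.\<close>

section \<open>The Riesz representation theorem\<close>

lemma parallelogram_midpoint:
  fixes x y :: "'a::real_inner"
  shows "(norm (x - y))\<^sup>2 = 2 * (norm x)\<^sup>2 + 2 * (norm y)\<^sup>2 - 4 * (norm ((1/2) *\<^sub>R (x + y)))\<^sup>2"
  by (simp add: power2_norm_eq_inner inner_simps inner_commute algebra_simps)

text \<open>A representing vector y gives \<open>J x\<close> = |x - y|^2 - |y|^2, so y is sought as
  a minimiser of \<open>J\<close>. The parallelogram law makes minimising sequences Cauchy.\<close>

lemma riesz_representation:
  fixes f :: "'a::{real_inner,complete_space} \<Rightarrow> real"
  assumes "bounded_linear f"
  shows "\<exists>y. \<forall>x. f x = inner x y"
proof -
  interpret f: bounded_linear f by fact
  define J where "J x = (norm x)\<^sup>2 - 2 * f x" for x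
  obtain K where K: "\<And>x. norm (f x) \<le> norm x * K"
    using f.bounded by blast
  have J_ge: "- K\<^sup>2 \<le> J x" for x
  proof -
    have "0 \<le> (norm x - K)\<^sup>2" by simp
    moreover have "f x \<le> norm x * K"
      using K [of x] by simp
    ultimately show ?thesis
      by (simp add: J_def power2_diff)
  qed
  define m where "m = (INF x. J x)"
  have bdd: "bdd_below (range J)"
    using J_ge by (auto intro!: bdd_belowI)
  have m_le: "m \<le> J x" for x
    unfolding m_def using bdd by (intro cINF_lower) auto
  have "\<exists>x. J x < m + 1 / Suc n" for n
  proof (rule ccontr)
    assume "\<nexists>x. J x < m + 1 / Suc n"
    then have "m + 1 / Suc n \<le> m"
      unfolding m_def by (intro cINF_greatest) (auto simp: not_less)
    then show False by simp
  qed
  then obtain X where X: "\<And>n. J (X n) < m + 1 / Suc n" by metis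
  \<comment> \<open>The linear part of \<open>J\<close> cancels in the parallelogram law, and the
    midpoint has \<open>J\<close>-value at least \<open>m\<close>, so the terms in \<open>m\<close>
    cancel too.\<close>
  have dist_X: "(norm (X i - X j))\<^sup>2 \<le> 2 / Suc i + 2 / Suc j" for i j
  proof -
    have "(norm (X i - X j))\<^sup>2 = 2 * J (X i) + 2 * J (X j) - 4 * J ((1/2) *\<^sub>R (X i + X j))"
      unfolding J_def parallelogram_midpoint
      by (simp add: f.add f.scaleR algebra_simps)
    then show ?thesis
      using X [of i] X [of j] m_le [of "(1/2) *\<^sub>R (X i + X j)"] by simp
  qed
  have "Cauchy X"
  proof (rule metric_CauchyI)
    fix e :: real assume "e > 0"
    then obtain N where N: "4 / e\<^sup>2 < of_nat N" using reals_Archimedean2 by blast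
    have "dist (X i) (X j) < e" if "i \<ge> N" "j \<ge> N" for i j
    proof -
      have e2: "e\<^sup>2 > 0" using \<open>e > 0\<close> by simp
      have N0: "real N > 0" using N e2 by (smt (verit) divide_pos_pos)
      have "2 / Suc i \<le> 2 / N" "2 / Suc j \<le> 2 / N"
        using that N0 by (auto intro!: divide_left_mono)
      then have "(norm (X i - X j))\<^sup>2 \<le> 4 / N"
        using dist_X [of i j] by simp
      also have "\<dots> < e\<^sup>2"
        using N e2 N0 by (simp add: field_simps)
      finally show ?thesis
        using \<open>e > 0\<close> by (simp add: dist_norm power2_less_imp_less)
    qed
    then show "\<exists>M. \<forall>i\<ge>M. \<forall>j\<ge>M. dist (X i) (X j) < e" by blast
  qed
  then obtain y where y: "X \<longlonglongrightarrow> y"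
    using Cauchy_convergent convergent_def by blast
  have "(\<lambda>n. J (X n)) \<longlonglongrightarrow> J y"
    unfolding J_def by (intro tendsto_intros y f.tendsto)
  moreover have "(\<lambda>n. m + 1 / Suc n) \<longlonglongrightarrow> m + 0"
    by (intro tendsto_intros LIMSEQ_Suc [OF lim_1_over_n])
  ultimately have "J y \<le> m + 0"
    using X by (intro LIMSEQ_le) (auto intro: less_imp_le)
  then have J_min: "J y \<le> J z" for z
    using m_le [of z] by simp
  have "f x = inner x y" for x
  proof (cases "x = 0")
    case True
    then show ?thesis by (simp add: f.zero)
  next
    case False
    define d where "d = f x - inner x y"
    \<comment> \<open>This \<open>t\<close> minimises \<open>J\<close> on the line through
      \<open>y\<close> in direction \<open>x\<close>; the gain
      \<open>d\<^sup>2 / (norm x)\<^sup>2\<close> must vanish by minimality.\<close>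
    define t where "t = d / (norm x)\<^sup>2"
    have n0: "(norm x)\<^sup>2 \<noteq> 0" using False by simp
    have "J (y + t *\<^sub>R x) = J y - 2 * t * d + t\<^sup>2 * (norm x)\<^sup>2"
      unfolding J_def d_def f.add f.scaleR power2_norm_eq_inner
      by (simp add: inner_simps inner_commute algebra_simps power2_eq_square)
    also have "\<dots> = J y - d\<^sup>2 / (norm x)\<^sup>2"
      using n0 by (simp add: t_def power2_eq_square field_simps)
    finally have "d\<^sup>2 / (norm x)\<^sup>2 \<le> 0"
      using J_min [of "y + t *\<^sub>R x"] by simp
    then have "d = 0"
      using n0 by (auto simp: divide_le_0_iff)
    then show ?thesis by (simp add: d_def)
  qed
  then show ?thesis by blast
qed

section \<open>Adjoints through the real inner product\<close>

text \<open>This makes the operator space complete, as the square root series and the fixed points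
  for the inverse require.\<close>

instance complex_hilbert_space \<subseteq> banach ..

lemma cinner_eq_inner:
  "cinner x y = Complex (inner x y) (inner (scaleC (- \<i>) x) y)"
  for x y :: "'a::complex_hilbert_space"
  by (simp add: complex_eq_iff inner_eq_Re_cinner cinner_scaleC_left)

lemma cinner_ext:
  fixes y z :: "'a::complex_hilbert_space"
  assumes "\<And>x. cinner x y = cinner x z"
  shows "y = z"
proof -
  have "inner x y = inner x z" for x
    using assms [of x] by (simp add: inner_eq_Re_cinner)
  then show ?thesis
    by (metis vector_eq_ldot)
qed

lemma inner_scaleC_right:
  "inner x (scaleC c y) = inner (scaleC (cnj c) x) y"
  for x y :: "'a::complex_hilbert_space"
proof -
  have "cinner x (scaleC c y) = cnj c * cinner x y"
    by (metis cinner_commute cinner_scaleC_left complex_cnj_mult)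
  then show ?thesis
    by (simp add: inner_eq_Re_cinner cinner_scaleC_left)
qed

lemma bounded_opsD: "T \<in> bounded_ops \<Longrightarrow> T (scaleC c x) = scaleC c (T x)"
  by (simp add: bounded_ops_def)

text \<open>The imaginary part of \<open>cinner (T x) y\<close> is a real inner product with
  \<open>x\<close> replaced by -i x, because \<open>T\<close> is complex-linear. Adjoints can
  therefore be handled with \<open>inner\<close> alone.\<close>

lemma bounded_ops_cinner_adjoint_iff:
  assumes "T \<in> bounded_ops"
  shows "(\<forall>x y. cinner (T x) y = cinner x (S y)) \<longleftrightarrow> (\<forall>x y. inner (T x) y = inner x (S y))"
proof
  assume "\<forall>x y. inner (T x) y = inner x (S y)"
  then show "\<forall>x y. cinner (T x) y = cinner x (S y)"
    by (simp add: cinner_eq_inner flip: bounded_opsD [OF assms])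
qed (simp add: inner_eq_Re_cinner)

lemma adjoint_exists:
  fixes T :: "'a::complex_hilbert_space \<Rightarrow>\<^sub>L 'a"
  assumes "T \<in> bounded_ops"
  shows "\<exists>S\<in>bounded_ops. \<forall>x y. cinner (T x) y = cinner x (S y)"
proof -
  have "\<exists>z. \<forall>x. inner (T x) y = inner x z" for y
    by (rule riesz_representation) (intro bounded_linear_intros)
  then obtain S where S: "\<And>x y. inner (T x) y = inner x (S y)" by metis
  have ext: "u = v" if "\<And>x. inner x u = inner x v" for u v :: 'a
    using that by (metis vector_eq_ldot)
  have "bounded_linear S"
  proof (rule bounded_linear_intro)
    show "S (x + y) = S x + S y" for x y
      by (rule ext) (simp add: inner_add_right flip: S)
    show "S (r *\<^sub>R x) = r *\<^sub>R S x" for r x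
      by (rule ext) (simp flip: S)
    \<comment> \<open>Testing the defining identity at x = \<open>S y\<close> turns its right side
      into the squared norm of \<open>S y\<close>.\<close>
    show "norm (S y) \<le> norm y * norm T" for y
    proof (cases "S y = 0")
      case False
      have "norm (S y) * norm (S y) = inner (T (S y)) y"
        by (simp add: S flip: power2_norm_eq_inner power2_eq_square)
      also have "\<dots> \<le> norm (T (S y)) * norm y"
        by (rule norm_cauchy_schwarz)
      also have "\<dots> \<le> norm T * norm (S y) * norm y"
        by (intro mult_right_mono norm_blinfun) simp
      finally show ?thesis using False by (simp add: mult.commute)
    qed simp
  qed
  then have eq: "blinfun_apply (Blinfun S) = S"
    by (rule bounded_linear_Blinfun_apply)
  have "Blinfun S \<in> bounded_ops"
    unfolding bounded_ops_def mem_Collect_eq eq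
    by (intro allI ext) (simp add: inner_scaleC_right bounded_opsD [OF assms] flip: S)
  moreover have "\<forall>x y. cinner (T x) y = cinner x (Blinfun S y)"
    unfolding bounded_ops_cinner_adjoint_iff [OF assms] eq using S by blast
  ultimately show ?thesis by blast
qed

lemma adj_eqI:
  fixes S T :: "'a::complex_hilbert_space \<Rightarrow>\<^sub>L 'a"
  assumes "S \<in> bounded_ops" "\<And>x y. cinner (T x) y = cinner x (S y)"
  shows "adj T = S"
  unfolding adj_def
proof (rule the_equality)
  show "R = S" if "R \<in> bounded_ops \<and> (\<forall>x y. cinner (T x) y = cinner x (R y))" for R
    using that assms(2) by (intro blinfun_eqI cinner_ext) metis
qed (use assms in auto)

text \<open>\<open>adj T = T\<close> carries information only once an adjoint is known to exist;
  with \<open>adjoint_exists\<close> it becomes the symmetry identity.\<close>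

lemma selfadjoint_ops_iff:
  "T \<in> selfadjoint_ops \<longleftrightarrow> T \<in> bounded_ops \<and> (\<forall>x y. inner (T x) y = inner x (T y))"
proof -
  have "adj T = T \<longleftrightarrow> (\<forall>x y. cinner (T x) y = cinner x (T y))" if T: "T \<in> bounded_ops"
  proof
    assume "adj T = T"
    then show "\<forall>x y. cinner (T x) y = cinner x (T y)"
      using adjoint_exists [OF T] adj_eqI by metis
  qed (simp add: adj_eqI T)
  then show ?thesis
    by (auto simp: selfadjoint_ops_def bounded_ops_cinner_adjoint_iff)
qed

lemma positive_ops_iff:
  "T \<in> positive_ops \<longleftrightarrow> T \<in> selfadjoint_ops \<and> (\<forall>x. 0 \<le> inner (T x) x)"
  by (simp add: positive_ops_def inner_eq_Re_cinner)

lemma selfadjointD: "T \<in> selfadjoint_ops \<Longrightarrow> inner (T x) y = inner x (T y)"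
  by (simp add: selfadjoint_ops_iff)

lemma positiveD: "T \<in> positive_ops \<Longrightarrow> 0 \<le> inner (T x) x"
  by (simp add: positive_ops_iff)

lemma positive_imp_selfadjoint: "T \<in> positive_ops \<Longrightarrow> T \<in> selfadjoint_ops"
  by (simp add: positive_ops_iff)

lemma scaleC_right_distribs:
  fixes x y :: "'a::complex_hilbert_space"
  shows "scaleC c (x - y) = scaleC c x - scaleC c y"
    and "scaleC c (r *\<^sub>R x) = r *\<^sub>R scaleC c x"
    and "scaleC c 0 = (0::'a)"
  using linear_diff linear_scale linear_0 bounded_linear.linear [OF bounded_linear_scaleC [of c]]
  by blast+

section \<open>Self-adjoint and positive operators\<close>

lemma selfadjoint_zero: "0 \<in> selfadjoint_ops"
  by (simp add: selfadjoint_ops_iff bounded_ops_def scaleC_right_distribs)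

lemma selfadjoint_id: "id_blinfun \<in> selfadjoint_ops"
  by (simp add: selfadjoint_ops_iff bounded_ops_def)

lemma selfadjoint_add:
  "S \<in> selfadjoint_ops \<Longrightarrow> T \<in> selfadjoint_ops \<Longrightarrow> S + T \<in> selfadjoint_ops"
  by (simp add: selfadjoint_ops_iff bounded_ops_def blinfun.add_left inner_add_left inner_add_right
      scaleC_add_right)

lemma selfadjoint_diff:
  "S \<in> selfadjoint_ops \<Longrightarrow> T \<in> selfadjoint_ops \<Longrightarrow> S - T \<in> selfadjoint_ops"
  by (simp add: selfadjoint_ops_iff bounded_ops_def blinfun.diff_left inner_diff_left inner_diff_right
      scaleC_right_distribs)

lemma selfadjoint_scaleR: "T \<in> selfadjoint_ops \<Longrightarrow> r *\<^sub>R T \<in> selfadjoint_ops"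
  by (simp add: selfadjoint_ops_iff bounded_ops_def blinfun.scaleR_left scaleC_right_distribs)

lemma selfadjoint_compose:
  assumes "S \<in> selfadjoint_ops" "T \<in> selfadjoint_ops" "S o\<^sub>L T = T o\<^sub>L S"
  shows "S o\<^sub>L T \<in> selfadjoint_ops"
proof -
  have "S (T x) = T (S x)" for x
    using assms(3) by (metis blinfun_apply_blinfun_compose)
  then show ?thesis
    using assms(1,2) by (simp add: selfadjoint_ops_iff bounded_ops_def)
qed

lemmas selfadjoint_intros =
  selfadjoint_zero selfadjoint_id selfadjoint_add selfadjoint_diff selfadjoint_scaleR

lemma selfadjoint_limit:
  assumes "\<And>n. X n \<in> selfadjoint_ops" "X \<longlonglongrightarrow> Y"
  shows "Y \<in> selfadjoint_ops"
proof -
  have lim: "(\<lambda>n. X n x) \<longlonglongrightarrow> Y x" for x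
    by (intro tendsto_intros assms(2))
  have "Y (scaleC c x) = scaleC c (Y x)" for c x
  proof (rule LIMSEQ_unique)
    show "(\<lambda>n. X n (scaleC c x)) \<longlonglongrightarrow> scaleC c (Y x)"
      using bounded_linear.tendsto [OF bounded_linear_scaleC lim, of c x] assms(1)
      by (simp add: selfadjoint_ops_iff bounded_ops_def)
  qed (rule lim)
  moreover have "inner (Y x) y = inner x (Y y)" for x y
  proof (rule LIMSEQ_unique)
    show "(\<lambda>n. inner (X n x) y) \<longlonglongrightarrow> inner (Y x) y"
      by (intro tendsto_intros lim)
    show "(\<lambda>n. inner (X n x) y) \<longlonglongrightarrow> inner x (Y y)"
      unfolding selfadjointD [OF assms(1)] by (intro tendsto_intros lim)
  qed
  ultimately show ?thesis
    by (simp add: selfadjoint_ops_iff bounded_ops_def)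
qed

text \<open>|T x|^2 = <x, T^2 x>. Operator equations below are often obtained by squaring a
  difference.\<close>

lemma selfadjoint_square_eq_0:
  assumes "T \<in> selfadjoint_ops" "T o\<^sub>L T = 0"
  shows "T = 0"
proof (rule blinfun_eqI)
  fix x
  have "inner (T x) (T x) = inner x ((T o\<^sub>L T) x)"
    by (simp add: selfadjointD [OF assms(1)])
  then show "T x = blinfun_apply 0 x"
    using assms(2) by simp
qed

lemma positive_add:
  "S \<in> positive_ops \<Longrightarrow> T \<in> positive_ops \<Longrightarrow> S + T \<in> positive_ops"
  by (simp add: positive_ops_iff selfadjoint_add blinfun.add_left inner_add_left)

lemma positive_scaleR: "0 \<le> r \<Longrightarrow> T \<in> positive_ops \<Longrightarrow> r *\<^sub>R T \<in> positive_ops"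
  by (simp add: positive_ops_iff selfadjoint_scaleR blinfun.scaleR_left)

lemma positive_square:
  assumes "T \<in> selfadjoint_ops"
  shows "T o\<^sub>L T \<in> positive_ops"
proof -
  have "0 \<le> inner ((T o\<^sub>L T) x) x" for x
    using inner_ge_zero [of "T x"] selfadjointD [OF assms, of x "T x"] by (simp add: inner_commute)
  then show ?thesis
    by (simp add: positive_ops_iff selfadjoint_compose assms)
qed

text \<open>For \<open>0 \<le> T \<le> I\<close>, the identity \<open>T - T\<^sup>2 = T (I - T) T + (I - T) T (I - T)\<close> gives
  \<open>T\<^sup>2 \<le> T\<close>.\<close>

lemma norm_le_1_if_le_id:
  assumes "T \<in> positive_ops" "id_blinfun - T \<in> positive_ops"
  shows "norm T \<le> 1"
proof (rule norm_blinfun_bound)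
  fix x
  note T = selfadjointD [OF positive_imp_selfadjoint [OF assms(1)]]
  have "inner (T x) (T x) \<le> inner (T x) x"
    using positiveD [OF assms(1), of "x - T x"] positiveD [OF assms(2), of "T x"]
    by (simp add: blinfun.bilinear_simps inner_simps T)
  moreover have "inner (T x) x \<le> inner x x"
    using positiveD [OF assms(2), of x] by (simp add: blinfun.bilinear_simps inner_simps)
  ultimately show "norm (T x) \<le> 1 * norm x"
    by (simp add: norm_eq_sqrt_inner)
qed simp

lemma positive_id_minus:
  assumes X: "X \<in> selfadjoint_ops" and norm_X: "norm X \<le> 1"
  shows "id_blinfun - X \<in> positive_ops"
  unfolding positive_ops_iff
proof (intro conjI allI)
  show "id_blinfun - X \<in> selfadjoint_ops"
    by (intro selfadjoint_intros X)
  fix x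
  have "inner (X x) x \<le> norm (X x) * norm x"
    by (rule norm_cauchy_schwarz)
  also have "\<dots> \<le> 1 * norm x * norm x"
    by (intro mult_right_mono order_trans [OF norm_blinfun] norm_X) auto
  finally show "0 \<le> inner ((id_blinfun - X) x) x"
    by (simp add: blinfun.bilinear_simps inner_diff_left flip: power2_norm_eq_inner power2_eq_square)
qed

section \<open>Composition and square roots\<close>

lemma blinfun_compose_assoc: "(R o\<^sub>L S) o\<^sub>L T = R o\<^sub>L (S o\<^sub>L T)"
  by (rule blinfun_eqI) simp

lemma blinfun_compose_id [simp]: "id_blinfun o\<^sub>L T = T" "T o\<^sub>L id_blinfun = T"
  by (rule blinfun_eqI, simp)+

lemma blinfun_compose_commute_left:
  "S o\<^sub>L T = T o\<^sub>L S \<Longrightarrow> S o\<^sub>L (T o\<^sub>L R) = T o\<^sub>L (S o\<^sub>L R)"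
  by (metis blinfun_compose_assoc)

lemmas blinfun_compose_simps =
  bounded_bilinear.add_left [OF bounded_bilinear_blinfun_compose]
  bounded_bilinear.add_right [OF bounded_bilinear_blinfun_compose]
  bounded_bilinear.diff_left [OF bounded_bilinear_blinfun_compose]
  bounded_bilinear.diff_right [OF bounded_bilinear_blinfun_compose]
  bounded_bilinear.minus_left [OF bounded_bilinear_blinfun_compose]
  bounded_bilinear.minus_right [OF bounded_bilinear_blinfun_compose]
  bounded_bilinear.scaleR_left [OF bounded_bilinear_blinfun_compose]
  bounded_bilinear.scaleR_right [OF bounded_bilinear_blinfun_compose]
  bounded_bilinear.zero_left [OF bounded_bilinear_blinfun_compose]
  bounded_bilinear.zero_right [OF bounded_bilinear_blinfun_compose]

text \<open>The fixed-point iteration \<open>Y \<mapsto> (X + Y\<^sup>2) / 2\<close> for \<open>Y = I - (I - X)\<^bsup>1/2\<^esup>\<close>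
  is dominated by its scalar counterpart \<open>y \<mapsto> (1 + y\<^sup>2) / 2\<close>, which increases
  to 1. So it converges in norm even in the boundary case \<open>\<parallel>X\<parallel> = 1\<close>, where it is not a
  contraction.\<close>

lemma sqrt_id_minus_exists:
  fixes X :: "'a::complex_hilbert_space \<Rightarrow>\<^sub>L 'a"
  assumes X: "X \<in> selfadjoint_ops" and norm_X: "norm X \<le> 1"
  shows "\<exists>S\<in>positive_ops. S o\<^sub>L S = id_blinfun - X \<and>
           (\<forall>R. R o\<^sub>L X = X o\<^sub>L R \<longrightarrow> R o\<^sub>L S = S o\<^sub>L R)"
proof -
  define Y :: "nat \<Rightarrow> 'a \<Rightarrow>\<^sub>L 'a"
    where "Y = rec_nat 0 (\<lambda>_ Z. (1/2) *\<^sub>R (X + (Z o\<^sub>L Z)))"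
  define y :: "nat \<Rightarrow> real" where "y = rec_nat 0 (\<lambda>_ z. (1 + z\<^sup>2) / 2)"
  have Y0: "Y 0 = 0" and Y_Suc: "Y (Suc n) = (1/2) *\<^sub>R (X + (Y n o\<^sub>L Y n))" for n
    by (simp_all add: Y_def)
  have y0: "y 0 = 0" and y_Suc: "y (Suc n) = (1 + (y n)\<^sup>2) / 2" for n
    by (simp_all add: y_def)
  have commute: "R o\<^sub>L Y n = Y n o\<^sub>L R" if "R o\<^sub>L X = X o\<^sub>L R" for R n
  proof (induction n)
    case 0
    then show ?case by (simp add: Y0 blinfun_compose_simps)
  next
    case (Suc n)
    then show ?case
      using that by (simp add: Y_Suc blinfun_compose_simps blinfun_compose_assoc
          blinfun_compose_commute_left [OF Suc])
  qed
  have commute_Y: "Y m o\<^sub>L Y n = Y n o\<^sub>L Y m" for m n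
    by (rule commute, rule commute [symmetric]) simp
  have Y_sa: "Y n \<in> selfadjoint_ops" for n
    by (induction n) (auto simp: Y0 Y_Suc intro!: selfadjoint_intros X selfadjoint_compose)
  have y_bounds: "0 \<le> y n \<and> y n \<le> 1" for n
    by (induction n) (auto simp: y0 y_Suc power_le_one)
  have y_mono: "y n \<le> y (Suc n)" for n
    using zero_le_power2 [of "1 - y n"] unfolding y_Suc power2_diff by simp
  have norm_Y: "norm (Y n) \<le> y n" for n
  proof (induction n)
    case (Suc n)
    have "norm (Y n o\<^sub>L Y n) \<le> norm (Y n) * norm (Y n)"
      by (rule norm_blinfun_compose)
    also have "\<dots> \<le> y n * y n"
      using Suc by (intro mult_mono) (use y_bounds in auto)
    finally show ?case
      using norm_triangle_ineq [of X "Y n o\<^sub>L Y n"] norm_X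
      by (simp add: Y_Suc y_Suc power2_eq_square)
  qed (simp add: Y0 y0)
  have norm_step: "norm (Y (Suc n) - Y n) \<le> y (Suc n) - y n" for n
  proof (induction n)
    case 0
    show ?case using norm_X by (simp add: Y0 y0 Y_Suc y_Suc blinfun_compose_simps)
  next
    case (Suc n)
    let ?m = "Suc n"
    have "Y (Suc ?m) - Y ?m = (1/2) *\<^sub>R (X + (Y ?m o\<^sub>L Y ?m)) - (1/2) *\<^sub>R (X + (Y n o\<^sub>L Y n))"
      by (intro arg_cong2 [where f = "(-)"] Y_Suc)
    also have "\<dots> = (1/2) *\<^sub>R ((Y ?m o\<^sub>L Y ?m) - (Y n o\<^sub>L Y n))"
      by (simp add: scaleR_add_right scaleR_diff_right)
    \<comment> \<open>Factoring a difference of squares needs the iterates to commute. The scalar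
      sequence factors in the same way, so the bound is inherited.\<close>
    also have "(Y ?m o\<^sub>L Y ?m) - (Y n o\<^sub>L Y n) = (Y ?m - Y n) o\<^sub>L (Y ?m + Y n)"
      by (simp add: blinfun_compose_simps commute_Y [of n ?m])
    finally have "Y (Suc ?m) - Y ?m = (1/2) *\<^sub>R ((Y ?m - Y n) o\<^sub>L (Y ?m + Y n))" .
    moreover have "norm ((Y ?m - Y n) o\<^sub>L (Y ?m + Y n)) \<le> (y ?m - y n) * (y ?m + y n)"
    proof (rule order_trans [OF norm_blinfun_compose], rule mult_mono)
      show "norm (Y ?m + Y n) \<le> y ?m + y n"
        by (intro norm_triangle_le add_mono norm_Y)
    qed (use Suc y_mono in auto)
    ultimately have "norm (Y (Suc ?m) - Y ?m) \<le> (y ?m - y n) * (y ?m + y n) / 2"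
      by simp
    also have "\<dots> = (1 + (y ?m)\<^sup>2) / 2 - (1 + (y n)\<^sup>2) / 2"
      by (simp add: power2_eq_square field_simps)
    also have "\<dots> = y (Suc ?m) - y ?m"
      by (intro arg_cong2 [where f = "(-)"] y_Suc [symmetric])
    finally show ?case .
  qed
  have "summable (\<lambda>n. y (Suc n) - y n)"
  proof -
    have "incseq y" using y_mono by (rule incseq_SucI)
    then obtain L where "y \<longlonglongrightarrow> L"
      using incseq_convergent [of y 1] y_bounds by blast
    then show ?thesis by (rule sums_summable [OF telescope_sums])
  qed
  then have "summable (\<lambda>n. Y (Suc n) - Y n)"
    by (rule summable_comparison_test') (rule norm_step)
  then have "(\<lambda>n. \<Sum>i<n. Y (Suc i) - Y i) \<longlonglongrightarrow> (\<Sum>i. Y (Suc i) - Y i)"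
    by (rule summable_LIMSEQ)
  then obtain Z where Z: "Y \<longlonglongrightarrow> Z"
    by (auto simp: sum_lessThan_telescope Y0)
  note compose_tendsto = bounded_bilinear.tendsto [OF bounded_bilinear_blinfun_compose]
  have "(\<lambda>n. Y (Suc n)) \<longlonglongrightarrow> (1/2) *\<^sub>R (X + (Z o\<^sub>L Z))"
    unfolding Y_Suc by (intro tendsto_intros compose_tendsto Z)
  then have Z_eq: "Z = (1/2) *\<^sub>R (X + (Z o\<^sub>L Z))"
    using LIMSEQ_Suc [OF Z] LIMSEQ_unique by blast
  have "2 *\<^sub>R Z = X + (Z o\<^sub>L Z)"
    using arg_cong [OF Z_eq, of "\<lambda>W. 2 *\<^sub>R W"] by simp
  then have "Z o\<^sub>L Z = Z + Z - X"
    by (simp add: scaleR_2)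
  \<comment> \<open>Expanding the square gives I - 2Z + Z^2, where Z^2 = 2Z - X.\<close>
  then have square: "(id_blinfun - Z) o\<^sub>L (id_blinfun - Z) = id_blinfun - X"
    by (simp add: blinfun_compose_simps)
  have norm_Z: "norm Z \<le> 1"
    using tendsto_norm [OF Z]
    by (rule LIMSEQ_le_const2) (use norm_Y y_bounds order_trans in blast)
  have "id_blinfun - Z \<in> positive_ops"
    by (intro positive_id_minus selfadjoint_limit [OF Y_sa Z] norm_Z)
  moreover have "R o\<^sub>L (id_blinfun - Z) = (id_blinfun - Z) o\<^sub>L R" if "R o\<^sub>L X = X o\<^sub>L R" for R
  proof -
    have "(\<lambda>n. R o\<^sub>L Y n) \<longlonglongrightarrow> (R o\<^sub>L Z)" "(\<lambda>n. R o\<^sub>L Y n) \<longlonglongrightarrow> (Z o\<^sub>L R)"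
      by (intro compose_tendsto tendsto_const Z)
        (unfold commute [OF that], intro compose_tendsto tendsto_const Z)
    then have "R o\<^sub>L Z = Z o\<^sub>L R" by (rule LIMSEQ_unique)
    then show ?thesis by (simp add: blinfun_compose_simps)
  qed
  ultimately show ?thesis
    using square by blast
qed

lemma sqrt_exists:
  fixes T :: "'a::complex_hilbert_space \<Rightarrow>\<^sub>L 'a"
  assumes T: "T \<in> positive_ops"
  shows "\<exists>S\<in>positive_ops. S o\<^sub>L S = T \<and>
           (\<forall>R. R o\<^sub>L T = T o\<^sub>L R \<longrightarrow> R o\<^sub>L S = S o\<^sub>L R)"
proof -
  \<comment> \<open>Dividing by \<open>k\<close> puts \<open>T\<close> between 0 and I; the summand
    1 keeps \<open>k\<close> positive for \<open>T\<close> = 0.\<close>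
  define k where "k = norm T + 1"
  have k: "k > 0" by (simp add: k_def add_nonneg_pos)
  define X where "X = id_blinfun - (1/k) *\<^sub>R T"
  have X_sa: "X \<in> selfadjoint_ops"
    unfolding X_def by (intro selfadjoint_intros positive_imp_selfadjoint T)
  have "norm X \<le> 1"
  proof (rule norm_le_1_if_le_id)
    have "0 \<le> inner (X x) x" for x
    proof -
      have "inner (T x) x \<le> norm (T x) * norm x"
        by (rule norm_cauchy_schwarz)
      also have "\<dots> \<le> k * norm x * norm x"
        unfolding k_def
        by (intro mult_right_mono order_trans [OF norm_blinfun]) auto
      finally have "inner (T x) x \<le> k * inner x x"
        by (simp flip: power2_norm_eq_inner add: power2_eq_square)
      then show ?thesis
        using k by (simp add: X_def blinfun.bilinear_simps inner_simps field_simps)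
    qed
    then show "X \<in> positive_ops"
      using X_sa by (simp add: positive_ops_iff)
    show "id_blinfun - X \<in> positive_ops"
      using k T by (simp add: X_def positive_scaleR)
  qed
  then obtain S where S: "S \<in> positive_ops" "S o\<^sub>L S = id_blinfun - X"
      "\<And>R. R o\<^sub>L X = X o\<^sub>L R \<Longrightarrow> R o\<^sub>L S = S o\<^sub>L R"
    using sqrt_id_minus_exists [OF X_sa] by blast
  have "sqrt k *\<^sub>R S \<in> positive_ops"
    using k S(1) by (simp add: positive_scaleR)
  moreover have "sqrt k *\<^sub>R S o\<^sub>L sqrt k *\<^sub>R S = T"
    using k by (simp add: blinfun_compose_simps S(2) X_def)
  moreover have "R o\<^sub>L sqrt k *\<^sub>R S = sqrt k *\<^sub>R S o\<^sub>L R" if "R o\<^sub>L T = T o\<^sub>L R" for R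
    using S(3) [of R] that by (simp add: blinfun_compose_simps X_def)
  ultimately show ?thesis by blast
qed

text \<open>With S the root of \<open>T\<close>, <T x, x> = |S x|^2, and S x = 0 implies T x =
  0.\<close>

lemma positive_inner_eq_0D:
  assumes "T \<in> positive_ops" "inner (T x) x = 0"
  shows "T x = 0"
proof -
  obtain S where S: "S \<in> positive_ops" "S o\<^sub>L S = T"
    using sqrt_exists [OF assms(1)] by blast
  have "inner (S x) (S x) = inner (S (S x)) x"
    by (simp add: selfadjointD [OF positive_imp_selfadjoint [OF S(1)]])
  also have "\<dots> = 0"
    using assms(2) S(2) by auto
  finally show ?thesis
    using S(2) by (auto simp: blinfun.zero_right)
qed

text \<open>For y in the range of R - S, (R + S) y = 0. Thus the nonnegative numbers <R y, y> and <S
  y, y> sum to 0, so R and S both kill y and (R - S)^2 = 0.\<close>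

lemma sqrt_unique:
  assumes R: "R \<in> positive_ops" and S: "S \<in> positive_ops" and eq: "R o\<^sub>L R = S o\<^sub>L S"
    and commute: "R o\<^sub>L S = S o\<^sub>L R"
  shows "R = S"
proof -
  have sa: "R - S \<in> selfadjoint_ops"
    by (intro selfadjoint_intros positive_imp_selfadjoint R S)
  have "(R - S) o\<^sub>L (R - S) = 0"
  proof (rule blinfun_eqI)
    fix x
    define y where "y = (R - S) x"
    have "(R + S) o\<^sub>L (R - S) = 0"
      by (simp add: blinfun_compose_simps eq commute)
    then have "(R + S) y = 0"
      by (metis y_def blinfun_apply_blinfun_compose blinfun.zero_left)
    then have "R y + S y = 0"
      by (simp add: blinfun.add_left)
    then have "inner (R y) y + inner (S y) y = 0"
      by (simp flip: inner_add_left)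
    then have "inner (R y) y = 0" "inner (S y) y = 0"
      using positiveD [OF R, of y] positiveD [OF S, of y] by linarith+
    then have "R y = 0" "S y = 0"
      using R S positive_inner_eq_0D by blast+
    then show "((R - S) o\<^sub>L (R - S)) x = blinfun_apply 0 x"
      unfolding blinfun_apply_blinfun_compose y_def [symmetric]
      by (simp add: blinfun.diff_left)
  qed
  then have "R - S = 0"
    by (rule selfadjoint_square_eq_0 [OF sa])
  then show ?thesis by simp
qed

text \<open>Any positive root R of T commutes with T = R^2, hence with the root built in
  \<open>sqrt_exists\<close>. This supplies the commutation that \<open>sqrt_unique\<close> asks
  for.\<close>

lemma op_sqrt_eqI:
  assumes "S \<in> positive_ops" "S o\<^sub>L S = T"
  shows "op_sqrt T = S"
proof -
  have "T \<in> positive_ops"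
    using assms positive_square positive_imp_selfadjoint by blast
  then obtain Q where Q: "Q \<in> positive_ops" "Q o\<^sub>L Q = T"
      "\<And>R. R o\<^sub>L T = T o\<^sub>L R \<Longrightarrow> R o\<^sub>L Q = Q o\<^sub>L R"
    using sqrt_exists by blast
  have "R = Q" if "R \<in> positive_ops" "R o\<^sub>L R = T" for R
  proof (rule sqrt_unique [OF that(1) Q(1)])
    show "R o\<^sub>L Q = Q o\<^sub>L R"
      by (rule Q(3)) (metis that(2) blinfun_compose_assoc)
  qed (simp add: that Q)
  then show ?thesis
    unfolding op_sqrt_def using assms by (intro the_equality) blast+
qed

section \<open>Absolute values\<close>

lemma op_abs_selfadjoint:
  assumes u: "u \<in> selfadjoint_ops"
  shows op_abs_positive: "op_abs u \<in> positive_ops"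
    and op_abs_square: "op_abs u o\<^sub>L op_abs u = u o\<^sub>L u"
    and op_abs_commute: "R o\<^sub>L u = u o\<^sub>L R \<Longrightarrow> R o\<^sub>L op_abs u = op_abs u o\<^sub>L R"
proof -
  have "u o\<^sub>L u \<in> positive_ops"
    using u by (rule positive_square)
  then obtain Q where Q: "Q \<in> positive_ops" "Q o\<^sub>L Q = u o\<^sub>L u"
      "\<And>R. R o\<^sub>L (u o\<^sub>L u) = (u o\<^sub>L u) o\<^sub>L R \<Longrightarrow> R o\<^sub>L Q = Q o\<^sub>L R"
    using sqrt_exists by blast
  have "op_abs u = Q"
    using u unfolding op_abs_def selfadjoint_ops_def by (auto intro!: op_sqrt_eqI Q)
  then show "op_abs u \<in> positive_ops" "op_abs u o\<^sub>L op_abs u = u o\<^sub>L u"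
    using Q by blast+
  have "R o\<^sub>L (u o\<^sub>L u) = (u o\<^sub>L u) o\<^sub>L R" if "R o\<^sub>L u = u o\<^sub>L R"
    by (simp only: blinfun_compose_assoc blinfun_compose_commute_left [OF that] that)
  then show "R o\<^sub>L op_abs u = op_abs u o\<^sub>L R" if "R o\<^sub>L u = u o\<^sub>L R"
    using Q(3) that \<open>op_abs u = Q\<close> by blast
qed

lemma op_abs_eqI:
  assumes "u \<in> selfadjoint_ops" "S \<in> positive_ops" "S o\<^sub>L S = u o\<^sub>L u"
  shows "op_abs u = S"
  using assms unfolding op_abs_def selfadjoint_ops_def by (auto intro!: op_sqrt_eqI)

text \<open>With Q the root of S, the product is Q T Q, whose quadratic form is that of T at Q
  x.\<close>

lemma positive_compose:
  assumes S: "S \<in> positive_ops" and T: "T \<in> positive_ops" and commute: "S o\<^sub>L T = T o\<^sub>L S"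
  shows "S o\<^sub>L T \<in> positive_ops"
proof -
  obtain Q where Q: "Q \<in> positive_ops" "Q o\<^sub>L Q = S" "T o\<^sub>L Q = Q o\<^sub>L T"
    using sqrt_exists [OF S] commute by metis
  have "inner ((S o\<^sub>L T) x) x = inner (T (Q x)) (Q x)" for x
  proof -
    have "S o\<^sub>L T = Q o\<^sub>L (T o\<^sub>L Q)"
      using Q by (metis blinfun_compose_assoc)
    then show ?thesis
      by (simp add: selfadjointD [OF positive_imp_selfadjoint [OF Q(1)]])
  qed
  then have "\<forall>x. 0 \<le> inner ((S o\<^sub>L T) x) x"
    using positiveD [OF T] by presburger
  moreover have "S o\<^sub>L T \<in> selfadjoint_ops"
    by (intro selfadjoint_compose positive_imp_selfadjoint S T commute)
  ultimately show ?thesis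
    unfolding positive_ops_iff by blast
qed

text \<open>The right side is positive as a product of commuting positive operators and has the
  square of d u, so uniqueness of roots applies.\<close>

lemma op_abs_compose_positive:
  assumes d: "d \<in> positive_ops" and u: "u \<in> selfadjoint_ops" and du: "d o\<^sub>L u = u o\<^sub>L d"
  shows "op_abs (d o\<^sub>L u) = d o\<^sub>L op_abs u"
proof (rule op_abs_eqI)
  note c = op_abs_commute [OF u du]
  show "d o\<^sub>L u \<in> selfadjoint_ops"
    by (intro selfadjoint_compose positive_imp_selfadjoint d u du)
  show "d o\<^sub>L op_abs u \<in> positive_ops"
    by (intro positive_compose d op_abs_positive u c)
  have "(d o\<^sub>L op_abs u) o\<^sub>L (d o\<^sub>L op_abs u) = d o\<^sub>L (d o\<^sub>L (op_abs u o\<^sub>L op_abs u))"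
    by (simp add: blinfun_compose_assoc blinfun_compose_commute_left [OF c [symmetric]])
  also have "\<dots> = (d o\<^sub>L u) o\<^sub>L (d o\<^sub>L u)"
    by (simp add: op_abs_square [OF u] blinfun_compose_assoc
        blinfun_compose_commute_left [OF du [symmetric]])
  finally show "(d o\<^sub>L op_abs u) o\<^sub>L (d o\<^sub>L op_abs u) = (d o\<^sub>L u) o\<^sub>L (d o\<^sub>L u)" .
qed

text \<open>(S T)^2 = S^2 T^2 = S' (S' T') T' = 0. This carries a vanishing product over to absolute
  values.\<close>

lemma compose_eq_0_if_squares_eq:
  assumes S: "S \<in> selfadjoint_ops" and T: "T \<in> selfadjoint_ops" and ST: "S o\<^sub>L T = T o\<^sub>L S"
    and squares: "S o\<^sub>L S = S' o\<^sub>L S'" "T o\<^sub>L T = T' o\<^sub>L T'"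
    and zero: "S' o\<^sub>L T' = 0"
  shows "S o\<^sub>L T = 0"
proof (rule selfadjoint_square_eq_0)
  show "S o\<^sub>L T \<in> selfadjoint_ops"
    by (intro selfadjoint_compose S T ST)
  have "(S o\<^sub>L T) o\<^sub>L (S o\<^sub>L T) = (S o\<^sub>L S) o\<^sub>L (T o\<^sub>L T)"
    by (simp only: blinfun_compose_assoc blinfun_compose_commute_left [OF ST])
  also have "\<dots> = S' o\<^sub>L ((S' o\<^sub>L T') o\<^sub>L T')"
    by (simp only: squares blinfun_compose_assoc)
  finally show "(S o\<^sub>L T) o\<^sub>L (S o\<^sub>L T) = 0"
    by (simp add: zero blinfun_compose_simps)
qed

text \<open>With \<open>p = \<bar>u\<bar>\<close>, \<open>m = \<bar>p + u\<bar>\<close> and \<open>n = \<bar>p - u\<bar>\<close>, the identity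
  \<open>(p + u) (p - u) = 0\<close> gives \<open>m n = 0\<close> and \<open>m (p - u) = 0\<close>. Then
  \<open>m + n = 2 p\<close> by uniqueness of square roots, and these relations force \<open>p + u = m\<close>.\<close>

lemma op_abs_add_positive:
  assumes u: "u \<in> selfadjoint_ops"
  shows "op_abs u + u \<in> positive_ops"
proof -
  define p where "p = op_abs u"
  have p: "p \<in> selfadjoint_ops" "p \<in> positive_ops" and pp: "p o\<^sub>L p = u o\<^sub>L u"
    and pu: "p o\<^sub>L u = u o\<^sub>L p"
    using op_abs_positive [OF u] op_abs_square [OF u] op_abs_commute [OF u, of u]
      positive_imp_selfadjoint by (simp_all add: p_def)
  have sa: "p + u \<in> selfadjoint_ops" "p - u \<in> selfadjoint_ops"
    by (intro selfadjoint_intros p u)+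
  define m where "m = op_abs (p + u)"
  define n where "n = op_abs (p - u)"
  have m: "m \<in> positive_ops" "m \<in> selfadjoint_ops" and mm: "m o\<^sub>L m = (p + u) o\<^sub>L (p + u)"
    using op_abs_positive [OF sa(1)] op_abs_square [OF sa(1)] positive_imp_selfadjoint
    by (simp_all add: m_def)
  have n: "n \<in> positive_ops" "n \<in> selfadjoint_ops" and nn: "n o\<^sub>L n = (p - u) o\<^sub>L (p - u)"
    using op_abs_positive [OF sa(2)] op_abs_square [OF sa(2)] positive_imp_selfadjoint
    by (simp_all add: n_def)
  have pm: "p o\<^sub>L m = m o\<^sub>L p" and um: "u o\<^sub>L m = m o\<^sub>L u"
    unfolding m_def by (intro op_abs_commute sa; simp add: blinfun_compose_simps pu)+
  have pn: "p o\<^sub>L n = n o\<^sub>L p" and un: "u o\<^sub>L n = n o\<^sub>L u"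
    unfolding n_def by (intro op_abs_commute sa; simp add: blinfun_compose_simps pu)+
  have mn_commute: "m o\<^sub>L n = n o\<^sub>L m"
    unfolding n_def by (intro op_abs_commute sa) (simp add: blinfun_compose_simps pm um)
  have zero: "(p + u) o\<^sub>L (p - u) = 0"
    by (simp add: blinfun_compose_simps pp pu)
  have mn: "m o\<^sub>L n = 0"
    by (rule compose_eq_0_if_squares_eq [OF m(2) n(2) mn_commute mm nn zero])
  have m_diff: "m o\<^sub>L (p - u) = 0"
    by (rule compose_eq_0_if_squares_eq [OF m(2) sa(2) _ mm refl zero])
      (simp add: blinfun_compose_simps pm um)
  have "m + n = p + p"
  proof (rule sqrt_unique)
    show "m + n \<in> positive_ops" "p + p \<in> positive_ops"
      by (intro positive_add m n p)+
    \<comment> \<open>The cross terms vanish, and (p + u)^2 + (p - u)^2 = 2 p^2 + 2 u^2 = 4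
      p^2.\<close>
    show "(m + n) o\<^sub>L (m + n) = (p + p) o\<^sub>L (p + p)"
      using mn mn_commute by (simp add: blinfun_compose_simps mm nn pp pu)
    show "(m + n) o\<^sub>L (p + p) = (p + p) o\<^sub>L (m + n)"
      by (simp add: blinfun_compose_simps pm pn)
  qed
  then have "m o\<^sub>L (m + n) = m o\<^sub>L (p + p)" by simp
  then have m_p: "m o\<^sub>L m = (m o\<^sub>L p) + (m o\<^sub>L p)"
    using mn by (simp add: blinfun_compose_simps)
  have m_u: "m o\<^sub>L u = m o\<^sub>L p"
    using m_diff by (simp add: blinfun_compose_simps)
  have "m - (p + u) = 0"
  proof (rule selfadjoint_square_eq_0)
    show "m - (p + u) \<in> selfadjoint_ops"
      by (intro selfadjoint_intros m p u)
    \<comment> \<open>All four products in this expansion equal m^2, because m u = m p and 2 m p =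
      m^2.\<close>
    have "(m - (p + u)) o\<^sub>L (m - (p + u)) =
        (m o\<^sub>L m) - (m o\<^sub>L (p + u)) - ((p + u) o\<^sub>L m) + ((p + u) o\<^sub>L (p + u))"
      by (simp add: blinfun_compose_simps algebra_simps)
    also have "(p + u) o\<^sub>L (p + u) = m o\<^sub>L m"
      by (rule mm [symmetric])
    also have "(p + u) o\<^sub>L m = m o\<^sub>L m"
      using m_p m_u by (simp add: blinfun_compose_simps pm um)
    also have "m o\<^sub>L (p + u) = m o\<^sub>L m"
      using m_p m_u by (simp add: blinfun_compose_simps)
    finally show "(m - (p + u)) o\<^sub>L (m - (p + u)) = 0" by simp
  qed
  then show ?thesis
    using m(1) by (simp add: p_def)
qed

lemma op_abs_diff_positive:
  assumes u: "u \<in> selfadjoint_ops"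
  shows "op_abs u - u \<in> positive_ops"
proof -
  have minus: "- u \<in> selfadjoint_ops"
    using selfadjoint_scaleR [OF u, of "-1"] by simp
  have "op_abs (- u) = op_abs u"
    by (rule op_abs_eqI [OF minus op_abs_positive [OF u]])
      (simp add: op_abs_square [OF u] blinfun_compose_simps)
  then show ?thesis
    using op_abs_add_positive [OF minus] by simp
qed

section \<open>Inverses\<close>

lemma op_inverse_eqI:
  assumes "S \<in> bounded_ops" "S o\<^sub>L T = id_blinfun" "T o\<^sub>L S = id_blinfun"
  shows "op_inverse T = S"
  unfolding op_inverse_def
proof (rule the_equality)
  fix R assume R: "R \<in> bounded_ops \<and> R o\<^sub>L T = id_blinfun \<and> T o\<^sub>L R = id_blinfun"
  then have "R = R o\<^sub>L (T o\<^sub>L S)"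
    by (simp add: assms)
  also have "\<dots> = S"
    using R by (simp flip: blinfun_compose_assoc)
  finally show "R = S" .
qed (use assms in blast)

text \<open>Right and left inverses are the fixed points of the contractions S -> I + X S and S -> I
  + S X; associativity identifies them.\<close>

lemma id_minus_inverse:
  fixes X :: "'a::complex_hilbert_space \<Rightarrow>\<^sub>L 'a"
  assumes X: "X \<in> bounded_ops" and norm_X: "norm X < 1"
  shows "op_inverse (id_blinfun - X) \<in> bounded_ops"
    and id_minus_inverse_left: "op_inverse (id_blinfun - X) o\<^sub>L (id_blinfun - X) = id_blinfun"
    and id_minus_inverse_right: "(id_blinfun - X) o\<^sub>L op_inverse (id_blinfun - X) = id_blinfun"
proof -
  let ?c = "id_blinfun - X"
  have "norm ((id_blinfun + (X o\<^sub>L S)) - (id_blinfun + (X o\<^sub>L T))) \<le> norm X * norm (S - T)" for S T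
    using norm_blinfun_compose [of X "S - T"] by (simp add: blinfun_compose_simps)
  then obtain S where "id_blinfun + (X o\<^sub>L S) = S"
    using banach_fix_type [OF norm_ge_zero norm_X, of "\<lambda>S. id_blinfun + (X o\<^sub>L S)"]
    by (auto simp: dist_norm)
  then have right: "?c o\<^sub>L S = id_blinfun"
    by (simp add: blinfun_compose_simps algebra_simps)
  have "norm ((id_blinfun + (S o\<^sub>L X)) - (id_blinfun + (T o\<^sub>L X))) \<le> norm X * norm (S - T)" for S T
    using norm_blinfun_compose [of "S - T" X] by (simp add: blinfun_compose_simps mult.commute)
  then obtain R where "id_blinfun + (R o\<^sub>L X) = R"
    using banach_fix_type [OF norm_ge_zero norm_X, of "\<lambda>S. id_blinfun + (S o\<^sub>L X)"]
    by (auto simp: dist_norm)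
  then have left: "R o\<^sub>L ?c = id_blinfun"
    by (simp add: blinfun_compose_simps algebra_simps)
  have "R = R o\<^sub>L (?c o\<^sub>L S)"
    by (simp add: right)
  also have "\<dots> = S"
    by (simp add: left flip: blinfun_compose_assoc)
  finally have left: "S o\<^sub>L ?c = id_blinfun"
    using left by simp
  have cS: "?c (S x) = x" and Sc: "S (?c x) = x" for x
    using left right by (metis blinfun_apply_blinfun_compose blinfun_apply_id_blinfun)+
  \<comment> \<open>The fixed point lives among real-linear maps, so complex linearity is recovered
    from that of \<open>?c\<close>.\<close>
  have "S (scaleC c x) = scaleC c (S x)" for c x
  proof -
    have "?c (scaleC c (S x)) = scaleC c (?c (S x))"
      by (simp add: blinfun.diff_left scaleC_right_distribs bounded_opsD [OF X])
    then show ?thesis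
      using Sc [of "scaleC c (S x)"] cS [of x] by simp
  qed
  then have S: "S \<in> bounded_ops"
    by (simp add: bounded_ops_def)
  have "op_inverse ?c = S"
    by (rule op_inverse_eqI [OF S left right])
  then show "op_inverse ?c \<in> bounded_ops" "op_inverse ?c o\<^sub>L ?c = id_blinfun"
      "?c o\<^sub>L op_inverse ?c = id_blinfun"
    using S left right by simp_all
qed

text \<open>Substituting x = c (S x) gives <S x, x> = <S x, c (S x)>, a value of the quadratic form
  of c.\<close>

lemma positive_inverse:
  assumes c: "c \<in> positive_ops" and S: "S \<in> bounded_ops" "c o\<^sub>L S = id_blinfun"
  shows "S \<in> positive_ops"
proof -
  have cS: "c (S x) = x" for x
    using S(2) by (metis blinfun_apply_blinfun_compose blinfun_apply_id_blinfun)
  have "inner (S x) y = inner x (S y)" for x y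
    using selfadjointD [OF positive_imp_selfadjoint [OF c], of "S x" "S y"] by (simp add: cS)
  moreover have "0 \<le> inner (S x) x" for x
    using positiveD [OF c, of "S x"] by (simp add: cS inner_commute)
  ultimately show ?thesis
    using S(1) by (simp add: positive_ops_iff selfadjoint_ops_iff)
qed

text \<open>S T = S T c S = S c T S = T S.\<close>

lemma inverse_commute:
  assumes "S o\<^sub>L c = id_blinfun" "c o\<^sub>L S = id_blinfun" "c o\<^sub>L T = T o\<^sub>L c"
  shows "S o\<^sub>L T = T o\<^sub>L S"
proof -
  have "S o\<^sub>L T = S o\<^sub>L ((T o\<^sub>L c) o\<^sub>L S)"
    by (simp add: blinfun_compose_assoc assms(2))
  also have "\<dots> = (S o\<^sub>L c) o\<^sub>L (T o\<^sub>L S)"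
    by (simp add: blinfun_compose_assoc flip: assms(3))
  finally show ?thesis
    by (simp add: assms(1))
qed

section \<open>Effects, order intervals and the rescaling\<close>

lemma effects_iff:
  "a \<in> effects \<longleftrightarrow> a \<in> positive_ops \<and> id_blinfun - a \<in> positive_ops"
  by (auto simp: effects_def op_le_def positive_imp_selfadjoint)

lemma op_interval_half_iff:
  "w \<in> op_interval ((1/2) *\<^sub>R x) (id_blinfun - (1/2) *\<^sub>R x) \<longleftrightarrow>
     w \<in> selfadjoint_ops \<and> w - (1/2) *\<^sub>R x \<in> positive_ops \<and>
     id_blinfun - (1/2) *\<^sub>R x - w \<in> positive_ops"
  by (simp add: op_interval_def op_le_def)

lemma positive_halfI:
  assumes "2 *\<^sub>R T = S" "S \<in> positive_ops"
  shows "T \<in> positive_ops"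
  using positive_scaleR [of "1/2" S] assms by auto

lemma abs_sum_interval:
  assumes a: "a \<in> selfadjoint_ops" and b: "b \<in> selfadjoint_ops"
    and eq: "op_abs (a - b) + op_abs (id_blinfun - a - b) = id_blinfun - x"
  shows "a \<in> op_interval ((1/2) *\<^sub>R x) (id_blinfun - (1/2) *\<^sub>R x)"
    and "b \<in> op_interval ((1/2) *\<^sub>R x) (id_blinfun - (1/2) *\<^sub>R x)"
    and "dot_wedge a b \<in> op_interval ((1/2) *\<^sub>R x) (id_blinfun - (1/2) *\<^sub>R x)"
    and "dot_vee a b \<in> op_interval ((1/2) *\<^sub>R x) (id_blinfun - (1/2) *\<^sub>R x)"
proof -
  let ?I = "op_interval ((1/2) *\<^sub>R x) (id_blinfun - (1/2) *\<^sub>R x)"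
  define p where "p = op_abs (a - b)"
  define q where "q = op_abs (id_blinfun - a - b)"
  define w where "w = id_blinfun - a - b"
  have w: "w \<in> selfadjoint_ops" and ab: "a - b \<in> selfadjoint_ops"
    unfolding w_def by (intro selfadjoint_intros a b)+
  have p: "p \<in> positive_ops" "p + (a - b) \<in> positive_ops" "p - (a - b) \<in> positive_ops"
    and q: "q + w \<in> positive_ops" "q - w \<in> positive_ops"
    unfolding p_def q_def w_def [symmetric]
    by (intro op_abs_positive op_abs_add_positive op_abs_diff_positive w ab)+
  have "id_blinfun - (p + q) = x"
    using eq by (simp add: p_def q_def)
  then have x: "x = id_blinfun - p - q"
    by (simp add: diff_diff_eq)
  note double = scaleR_diff_right scaleR_add_right scaleR_2 x w_def
  have "2 *\<^sub>R (a - (1/2) *\<^sub>R x) = (p + (a - b)) + (q - w)"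
    by (simp add: double)
  then have "a - (1/2) *\<^sub>R x \<in> positive_ops"
    by (rule positive_halfI) (intro positive_add p q)
  moreover have "2 *\<^sub>R (id_blinfun - (1/2) *\<^sub>R x - a) = (p - (a - b)) + (q + w)"
    by (simp add: double)
  then have "id_blinfun - (1/2) *\<^sub>R x - a \<in> positive_ops"
    by (rule positive_halfI) (intro positive_add p q)
  ultimately show "a \<in> ?I"
    using a by (simp add: op_interval_half_iff)
  have "2 *\<^sub>R (b - (1/2) *\<^sub>R x) = (p - (a - b)) + (q - w)"
    by (simp add: double)
  then have "b - (1/2) *\<^sub>R x \<in> positive_ops"
    by (rule positive_halfI) (intro positive_add p q)
  moreover have "2 *\<^sub>R (id_blinfun - (1/2) *\<^sub>R x - b) = (p + (a - b)) + (q + w)"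
    by (simp add: double)
  then have "id_blinfun - (1/2) *\<^sub>R x - b \<in> positive_ops"
    by (rule positive_halfI) (intro positive_add p q)
  ultimately show "b \<in> ?I"
    using b by (simp add: op_interval_half_iff)
  have wedge: "dot_wedge a b = (1/2) *\<^sub>R (a + b - p)" and vee: "dot_vee a b = (1/2) *\<^sub>R (a + b + p)"
    by (simp_all add: dot_wedge_def dot_vee_def p_def)
  have sa: "dot_wedge a b \<in> selfadjoint_ops" "dot_vee a b \<in> selfadjoint_ops"
    unfolding wedge vee by (intro selfadjoint_intros a b positive_imp_selfadjoint p)+
  \<comment> \<open>The p from x cancels the one subtracted in \<open>dot_wedge\<close>.\<close>
  have "2 *\<^sub>R (dot_wedge a b - (1/2) *\<^sub>R x) = q - w"
    by (simp add: double wedge)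
  then have "dot_wedge a b - (1/2) *\<^sub>R x \<in> positive_ops"
    by (rule positive_halfI) (intro positive_add p q)
  moreover have "2 *\<^sub>R (id_blinfun - (1/2) *\<^sub>R x - dot_wedge a b) = (p + p) + (q + w)"
    by (simp add: double wedge)
  then have "id_blinfun - (1/2) *\<^sub>R x - dot_wedge a b \<in> positive_ops"
    by (rule positive_halfI) (intro positive_add p q)
  ultimately show "dot_wedge a b \<in> ?I"
    using sa by (simp add: op_interval_half_iff)
  have "2 *\<^sub>R (dot_vee a b - (1/2) *\<^sub>R x) = (p + p) + (q - w)"
    by (simp add: double vee)
  then have "dot_vee a b - (1/2) *\<^sub>R x \<in> positive_ops"
    by (rule positive_halfI) (intro positive_add p q)
  moreover have "2 *\<^sub>R (id_blinfun - (1/2) *\<^sub>R x - dot_vee a b) = q + w"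
    by (simp add: double vee)
  then have "id_blinfun - (1/2) *\<^sub>R x - dot_vee a b \<in> positive_ops"
    by (rule positive_halfI) (intro positive_add p q)
  ultimately show "dot_vee a b \<in> ?I"
    using sa by (simp add: op_interval_half_iff)
qed

lemma generated_von_neumann_algebra_superset: "A \<subseteq> generated_von_neumann_algebra A"
  by (auto simp: generated_von_neumann_algebra_def)

theorem proposition3p5:
  fixes a b x0 :: "'a::complex_hilbert_space \<Rightarrow>\<^sub>L 'a"
  assumes "a \<in> effects" and "b \<in> effects"
    and "x0 \<in> positive_ops"
    and "x0 \<in> op_centre (generated_von_neumann_algebra {a, b})"
    and "norm x0 < 1"
  shows "(compatible_rel x0 a b \<longrightarrow>
            a \<in> op_interval ((1/2) *\<^sub>R x0) (id_blinfun - (1/2) *\<^sub>R x0) \<and>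
            b \<in> op_interval ((1/2) *\<^sub>R x0) (id_blinfun - (1/2) *\<^sub>R x0)) \<and>
         (compatible_rel x0 a b \<longleftrightarrow>
            abs_compatible
              (op_inverse (id_blinfun - x0) o\<^sub>L (a - (1/2) *\<^sub>R x0))
              (op_inverse (id_blinfun - x0) o\<^sub>L (b - (1/2) *\<^sub>R x0))) \<and>
         (compatible_rel x0 a b \<longrightarrow>
            dot_wedge a b \<in> op_interval ((1/2) *\<^sub>R x0) (id_blinfun - (1/2) *\<^sub>R x0) \<and>
            dot_vee a b \<in> op_interval ((1/2) *\<^sub>R x0) (id_blinfun - (1/2) *\<^sub>R x0))"
proof -
  have a: "a \<in> selfadjoint_ops" and b: "b \<in> selfadjoint_ops" and x0: "x0 \<in> selfadjoint_ops"
    using assms by (simp_all add: effects_iff positive_imp_selfadjoint)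
  have commute: "x0 o\<^sub>L a = a o\<^sub>L x0" "x0 o\<^sub>L b = b o\<^sub>L x0"
    using assms(4) generated_von_neumann_algebra_superset [of "{a, b}"]
    by (auto simp: op_centre_def)
  define h where "h = (1/2) *\<^sub>R x0"
  have hh: "x0 = h + h"
    by (simp add: h_def flip: scaleR_2)
  define c where "c = id_blinfun - x0"
  define S where "S = op_inverse c"
  have x0_bounded: "x0 \<in> bounded_ops"
    using x0 by (simp add: selfadjoint_ops_iff)
  have c: "c \<in> positive_ops"
    unfolding c_def using positive_id_minus [OF x0] assms(5) by simp
  note S_inverse = id_minus_inverse [OF x0_bounded assms(5), folded c_def, folded S_def]
  have S: "S \<in> positive_ops"
    using positive_inverse [OF c S_inverse(1,3)] .
  have S_x0: "S o\<^sub>L x0 = x0 o\<^sub>L S" and S_a: "S o\<^sub>L a = a o\<^sub>L S" and S_b: "S o\<^sub>L b = b o\<^sub>L S"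
    by (rule inverse_commute [OF S_inverse(2,3)]; simp add: c_def blinfun_compose_simps commute)+
  have S_h: "S o\<^sub>L h = h o\<^sub>L S"
    using S_x0 by (simp add: h_def blinfun_compose_simps)
  have x0_effect: "x0 \<in> effects"
    using assms(3) c by (simp add: effects_iff c_def)
  define a' where "a' = S o\<^sub>L (a - h)"
  define b' where "b' = S o\<^sub>L (b - h)"
  have sa: "a - b \<in> selfadjoint_ops" "id_blinfun - a - b \<in> selfadjoint_ops"
    by (intro selfadjoint_intros a b)+
  have Sc: "id_blinfun = S o\<^sub>L (id_blinfun - (h + h))"
    using S_inverse(2) by (simp add: c_def flip: hh)
  \<comment> \<open>Writing I as S(I - 2h) shows that the rescaling respects complements. This is
    where the shift by exactly half of \<open>x0\<close> matters.\<close>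
  have compl: "id_blinfun - (S o\<^sub>L (T - h)) = S o\<^sub>L (id_blinfun - h - T)" for T
    by (subst Sc) (simp add: blinfun_compose_simps algebra_simps)
  have "a' - b' = S o\<^sub>L (a - b)"
    by (simp add: a'_def b'_def blinfun_compose_simps)
  then have abs1: "op_abs (a' - b') = S o\<^sub>L op_abs (a - b)"
    using op_abs_compose_positive [OF S sa(1)] by (simp add: blinfun_compose_simps S_a S_b)
  have "id_blinfun - a' - b' = S o\<^sub>L (id_blinfun - a - b)"
    unfolding a'_def b'_def compl by (simp add: blinfun_compose_simps)
  then have abs2: "op_abs (id_blinfun - a' - b') = S o\<^sub>L op_abs (id_blinfun - a - b)"
    using op_abs_compose_positive [OF S sa(2)] by (simp add: blinfun_compose_simps S_a S_b)
  let ?eq = "op_abs (a - b) + op_abs (id_blinfun - a - b) = c"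
  let ?eq' = "op_abs (a' - b') + op_abs (id_blinfun - a' - b') = id_blinfun"
  have eq_iff: "?eq' \<longleftrightarrow> ?eq"
  proof -
    have "?eq' \<longleftrightarrow> S o\<^sub>L (op_abs (a - b) + op_abs (id_blinfun - a - b)) = S o\<^sub>L c"
      by (simp add: abs1 abs2 S_inverse(2) blinfun_compose_simps)
    \<comment> \<open>\<open>S\<close> cancels on composing with \<open>c\<close> from the
      left.\<close>
    also have "\<dots> \<longleftrightarrow> ?eq"
      using S_inverse(3) by (metis blinfun_compose_assoc blinfun_compose_id(1))
    finally show ?thesis .
  qed
  have compat_iff: "compatible_rel x0 a b \<longleftrightarrow> ?eq"
    using assms x0_effect by (simp add: compatible_rel_def c_def)
  have effect: "S o\<^sub>L (T - h) \<in> effects"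
    if "T \<in> op_interval h (id_blinfun - h)" "S o\<^sub>L T = T o\<^sub>L S" for T
  proof -
    have "T - h \<in> positive_ops" "id_blinfun - h - T \<in> positive_ops"
      using that(1) by (simp_all add: op_interval_def op_le_def)
    then show ?thesis
      unfolding effects_iff compl
      by (intro conjI positive_compose S) (simp_all add: blinfun_compose_simps that(2) S_h)
  qed
  have intervals: "a \<in> op_interval h (id_blinfun - h)" "b \<in> op_interval h (id_blinfun - h)"
    "dot_wedge a b \<in> op_interval h (id_blinfun - h)" "dot_vee a b \<in> op_interval h (id_blinfun - h)"
    if "compatible_rel x0 a b"
    using abs_sum_interval [OF a b, of x0] that by (simp_all add: compatible_rel_def h_def)
  \<comment> \<open>From left to right, \<open>intervals\<close> and \<open>effect\<close> make
    \<open>a'\<close> and \<open>b'\<close> effects; from right to left, \<open>compat_iff\<close>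
    recovers the relation from the equation.\<close>
  have "compatible_rel x0 a b \<longleftrightarrow> abs_compatible a' b'"
    unfolding abs_compatible_def eq_iff compat_iff [symmetric]
    using intervals effect S_a S_b by (auto simp: a'_def b'_def)
  then show ?thesis
    using intervals by (simp add: a'_def b'_def S_def c_def h_def)
qed

end
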